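(* Let the PDE problem, the approximations $F_{\boldsymbol\alpha,\boldsymbol\beta}$, the mixed differences $\boldsymbol\Delta[F_{\boldsymbol\alpha,\boldsymbol\beta}]$, the estimator $\mathscr M_{\mathcal I}[F]$, and the quantities $\Delta W_{\boldsymbol\alpha,\boldsymbol\beta}$, $\Delta E_{\boldsymbol\alpha,\boldsymbol\beta}$, $\mathrm{Work}[\cdot]$, $\mathrm{Error}[\cdot]$ be as defined in the context. Assume that: (A) There are constants $h_0, C_{m,low}, C_{m,up}>0$ such that $h_{i,\alpha_i}=h_0 2^{-\alpha_i}$ and $C_{m,low}2^{\beta_i}\le m(\beta_i)\le C_{m,up}2^{\beta_i}$ for all directions $i$ and all levels $\alpha_i,\beta_i\in\mathbb N_+$. (B) For all $[\boldsymbol\alpha,\boldsymbol\beta]\in\mathbb N_+^{D+N}$, $\Delta E_{\boldsymbol\alpha,\boldsymbol\beta}\le \Delta E^{\mathrm{det}}_{\boldsymbol\alpha}\,\Delta E^{\mathrm{stoc}}_{\boldsymbol\beta}$ and $\Delta W_{\boldsymbol\alpha,\boldsymbol\beta}\le \Delta W^{\mathrm{det}}_{\boldsymbol\alpha}\,\Delta W^{\mathrm{stoc}}_{\boldsymbol\beta}$, where $\Delta W^{\mathrm{det}}_{\boldsymbol\alpha},\Delta E^{\mathrm{det}}_{\boldsymbol\alpha}$ denote the cost and error contributions due to the deterministic difference operator and $\Delta W^{\mathrm{stoc}}_{\boldsymbol\beta},\Delta E^{\mathrm{stoc}}_{\boldsymbol\beta}$ those due to the stochastic difference operator. (C) There are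 positive constants $C^{\mathrm{det}}_{\mathrm{work}}, C^{\mathrm{det}}_{\mathrm{error}}, \widetilde C^{\mathrm{stoc}}_{\mathrm{work}}, C^{\mathrm{stoc}}_{\mathrm{work}}, C^{\mathrm{stoc}}_{\mathrm{error}}$ and rates $\widetilde\gamma_i,\widetilde r_i>0$ ($i=1,\dots,D$), $\widetilde g_n>0$ ($n=1,\dots,N$) such that for all $\boldsymbol\alpha\in\mathbb N_+^D$, $\boldsymbol\beta\in\mathbb N_+^N$ $$\Delta W^{\mathrm{det}}_{\boldsymbol\alpha}\le C^{\mathrm{det}}_{\mathrm{work}}\prod_{i=1}^D (h_{i,\alpha_i})^{-\widetilde\gamma_i},\qquad \Delta E^{\mathrm{det}}_{\boldsymbol\alpha}\le C^{\mathrm{det}}_{\mathrm{error}}\prod_{i=1}^D (h_{i,\alpha_i})^{\widetilde r_i},$$ $$\Delta W^{\mathrm{stoc}}_{\boldsymbol\beta}\le \widetilde C^{\mathrm{stoc}}_{\mathrm{work}}\prod_{n=1}^N m(\beta_n)\le C^{\mathrm{stoc}}_{\mathrm{work}}\prod_{n=1}^N 2^{\beta_n},\qquad \Delta E^{\mathrm{stoc}}_{\boldsymbol\beta}\le C^{\mathrm{stoc}}_{\mathrm{error}}\,e^{-\sum_{n=1}^N\widetilde g_n m(\beta_n)}.$$ Then the bounds can be rewritten as follows: there are constants $C_{\mathrm{work}},C_{\mathrm{error}}>0$ such that for all $[\boldsymbol\alpha,\boldsymbol\beta]\in\mathbb N_+^{D+N}$ $$\Delta W_{\boldsymbol\alpha,\boldsymbol\beta}\le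 C_{\mathrm{work}}\,e^{\sum_{i=1}^D\gamma_i\alpha_i}\,e^{\delta|\boldsymbol\beta|},\qquad \Delta E_{\boldsymbol\alpha,\boldsymbol\beta}\le C_{\mathrm{error}}\,e^{-\sum_{i=1}^D r_i\alpha_i}\,e^{-\sum_{j=1}^N g_j\exp(\delta\beta_j)},$$ with $\gamma_i=\widetilde\gamma_i\log 2$, $r_i=\widetilde r_i\log 2$, $\delta=\log 2$ and $g_j=\widetilde g_j C_{m,low}$. Define, for $L\in\mathbb R$, $$\mathcal I^*(L)=\Big\{[\boldsymbol\alpha,\boldsymbol\beta]\in\mathbb N_+^{D+N}:\ \sum_{i=1}^D (r_i+\gamma_i)\alpha_i+\sum_{j=1}^N\big(\delta\beta_j+g_j e^{\delta\beta_j}\big)\le L\Big\},$$ and let $$\chi=\max_{1\le i\le D}\frac{\gamma_i}{\gamma_i+r_i},\qquad \zeta=\min_{1\le i\le D}\frac{r_i}{\gamma_i},\qquad \mathfrak z=\#\Big\{i\in\{1,\dots,D\}:\ \frac{r_i}{\gamma_i}=\zeta\Big\}.$$ Then there exists a constant $\mathscr C_{\mathrm W}>0$ such that, for any $W_{\max}$ satisfying $W_{\max}\ge\mathscr C_{\mathrm W}\exp(\chi)$, and choosing $$L=L(W_{\max})=\frac1\chi\left(\log\Big(\frac{W_{\max}}{\mathscr C_{\mathrm W}}\Big)-(\mathfrak z-1)\log\Big(\frac1\chi\log\Big(\frac{W_{\max}}{\mathscr C_{\mathrm W}}\Big)\Big)\right),$$ the MISC estimator $\mathscr M_{\mathcal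 I^*(L(W_{\max}))}[F]$ satisfies $$\mathrm{Work}\big[\mathscr M_{\mathcal I^*(L(W_{\max}))}[F]\big]\le W_{\max},$$ $$\limsup_{W_{\max}\uparrow\infty}\frac{\mathrm{Error}\big[\mathscr M_{\mathcal I^*(L(W_{\max}))}[F]\big]}{W_{\max}^{-\zeta}\,\big(\log W_{\max}\big)^{(\zeta+1)(\mathfrak z-1)}}=\mathscr C_{\mathrm E}<\infty .$$
   Context: Notation: $\mathbb N=\{0,1,2,\dots\}$, $\mathbb N_+=\{1,2,\dots\}$; for a vector $\boldsymbol v$, $|\boldsymbol v|=\sum_n v_n$; $[\boldsymbol v,\boldsymbol w]$ is concatenation. $D,N\ge1$ are integers. Problem. $\mathscr B\subset\mathbb R^d$ ($d=1,2,3$) is an open hyper-rectangle; $\boldsymbol y=(y_1,\dots,y_N)$ is a random vector with independent components, $y_n$ uniform on $\Gamma_n\subset\mathbb R$; $\Gamma=\Gamma_1\times\cdots\times\Gamma_N$ with product density $\rho$. $u:\mathscr B\times\Gamma\to\mathbb R$ solves, for $\rho$-a.e. $\boldsymbol y$, a PDE $\mathcal L(u;\boldsymbol x,\boldsymbol y)=\mathscr F(\boldsymbol x)$ in $\mathscr B$, $u=0$ on $\partial\mathscr B$, assumed well posed in a Hilbert space $V$ for $\rho$-a.e. $\boldsymbol y$. $\Theta:V\to\mathbb R$ is a functional, $F(\boldsymbol y)=\Theta[u(\cdot,\boldsymbol y)]$, and the target is $\mathbb E[F]=\int_\Gamma F(\boldsymbol y)\rho(\boldsymbol y)\,d\boldsymbol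 y$. Discretization. A numerical solver depends on $D$ discretization parameters $h_1,\dots,h_D$; for each $i$ there is a sequence $h_{i,\alpha}$, $\alpha=1,2,\dots$. For $\boldsymbol\alpha\in\mathbb N_+^D$, $u^{\boldsymbol\alpha}$ is the approximation of $u$ obtained with $h_i=h_{i,\alpha_i}$, with $u^{\boldsymbol\alpha}\to u$ as $\min_i\alpha_i\to\infty$ for $\rho$-a.e. $\boldsymbol y$, and $F^{\boldsymbol\alpha}(\boldsymbol y)=\Theta[u^{\boldsymbol\alpha}(\cdot,\boldsymbol y)]$, assumed continuous on $\Gamma$. Let $m:\mathbb N\to\mathbb N$ be strictly increasing with $m(0)=0$, $m(1)=1$. For each $n$ and $\beta_n\in\mathbb N_+$, $\mathscr U_n^{m(\beta_n)}$ is the univariate Lagrange interpolation operator on $m(\beta_n)$ given collocation points in $\Gamma_n$. For $\boldsymbol\beta\in\mathbb N_+^N$, $\mathscr U^{m(\boldsymbol\beta)}=\bigotimes_{n=1}^N\mathscr U_n^{m(\beta_n)}$, $\mathscr Q^{m(\boldsymbol\beta)}[f]=\mathbb E\big[\mathscr U^{m(\boldsymbol\beta)}[f]\big]$, and $F_{\boldsymbol\alpha,\boldsymbol\beta}=\mathscr Q^{m(\boldsymbol\beta)}[F^{\boldsymbol\alpha}]$. Mixed differences. With the convention $F_{\boldsymbol v,\boldsymbol w}=0$ whenever a component of $\boldsymbol v$ or $\boldsymbol w$ is zero, define the deterministic and stochastic difference operators $$\boldsymbol\Delta^{\mathrm{det}}[F_{\boldsymbol\alpha,\boldsymbol\beta}]=\sum_{\boldsymbol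 j\in\{0,1\}^D}(-1)^{|\boldsymbol j|}F_{\boldsymbol\alpha-\boldsymbol j,\boldsymbol\beta},\qquad \boldsymbol\Delta^{\mathrm{stoc}}[F_{\boldsymbol\alpha,\boldsymbol\beta}]=\sum_{\boldsymbol j\in\{0,1\}^N}(-1)^{|\boldsymbol j|}F_{\boldsymbol\alpha,\boldsymbol\beta-\boldsymbol j},$$ and $\boldsymbol\Delta[F_{\boldsymbol\alpha,\boldsymbol\beta}]=\boldsymbol\Delta^{\mathrm{stoc}}\big[\boldsymbol\Delta^{\mathrm{det}}[F_{\boldsymbol\alpha,\boldsymbol\beta}]\big]$. MISC estimator. For $\mathcal I\subset\mathbb N_+^{D+N}$ finite, $\mathscr M_{\mathcal I}[F]=\sum_{[\boldsymbol\alpha,\boldsymbol\beta]\in\mathcal I}\boldsymbol\Delta[F_{\boldsymbol\alpha,\boldsymbol\beta}]$. Work and error. $\Delta W_{\boldsymbol\alpha,\boldsymbol\beta}\ge0$ (work contribution) is the computational cost of adding $\boldsymbol\Delta[F_{\boldsymbol\alpha,\boldsymbol\beta}]$ to the estimator, and $\mathrm{Work}[\mathscr M_{\mathcal I}[F]]=\sum_{[\boldsymbol\alpha,\boldsymbol\beta]\in\mathcal I}\Delta W_{\boldsymbol\alpha,\boldsymbol\beta}$. The error contribution is $\Delta E_{\boldsymbol\alpha,\boldsymbol\beta}=|\boldsymbol\Delta[F_{\boldsymbol\alpha,\boldsymbol\beta}]|$, and $\mathrm{Error}[\mathscr M_{\mathcal I}[F]]=|\mathbb E[F]-\mathscr M_{\mathcal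 I}[F]|$. It is a standing assumption that the full telescoping series reproduces the target, $\mathbb E[F]=\sum_{[\boldsymbol\alpha,\boldsymbol\beta]\in\mathbb N_+^{D+N}}\boldsymbol\Delta[F_{\boldsymbol\alpha,\boldsymbol\beta}]$, so that $\mathrm{Error}[\mathscr M_{\mathcal I}[F]]=\big|\sum_{[\boldsymbol\alpha,\boldsymbol\beta]\notin\mathcal I}\boldsymbol\Delta[F_{\boldsymbol\alpha,\boldsymbol\beta}]\big|\le\sum_{[\boldsymbol\alpha,\boldsymbol\beta]\notin\mathcal I}\Delta E_{\boldsymbol\alpha,\boldsymbol\beta}$. *)

theory Defs
  imports "HOL-Analysis.Analysis"
begin

section \<open>The parametric problem\<close>

text \<open>The parameters range over a product set; \<^term>\<open>unif_density \<Gamma>\<close> is the joint density of independent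
  components, the component with index \<open>n\<close> being uniform on \<open>\<Gamma> n\<close>.\<close>

definition param_domain :: "('N \<Rightarrow> real set) \<Rightarrow> (real ^ 'N) set"
  where "param_domain \<Gamma> = {y. \<forall>n. y $ n \<in> \<Gamma> n}"

definition unif_density :: "('N::finite \<Rightarrow> real set) \<Rightarrow> real ^ 'N \<Rightarrow> real"
  where "unif_density \<Gamma> y = (\<Prod>n\<in>UNIV. indicator (\<Gamma> n) (y $ n) / measure lborel (\<Gamma> n))"

definition param_law :: "('N::finite \<Rightarrow> real set) \<Rightarrow> (real ^ 'N) measure"
  where "param_law \<Gamma> = density lborel (\<lambda>y. ennreal (unif_density \<Gamma> y))"

definition expect :: "('N::finite \<Rightarrow> real set) \<Rightarrow> (real ^ 'N \<Rightarrow> real) \<Rightarrow> real"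
  where "expect \<Gamma> f = integral\<^sup>L (param_law \<Gamma>) f"

text \<open>The elements of the Hilbert space are realised as functions by \<open>ev\<close> (a choice of
  representatives when they are equivalence classes), and the differential operator is an arbitrary
  map \<open>Lop\<close> on functions.\<close>

definition pde_solution ::
  "('x::topological_space) set \<Rightarrow> (('x \<Rightarrow> real) \<Rightarrow> 'x \<Rightarrow> 'y \<Rightarrow> real) \<Rightarrow> ('x \<Rightarrow> real) \<Rightarrow>
   ('v \<Rightarrow> 'x \<Rightarrow> real) \<Rightarrow> 'y \<Rightarrow> 'v \<Rightarrow> bool"
  where "pde_solution B Lop rhs ev y v \<longleftrightarrow>
    (\<forall>x\<in>B. Lop (ev v) x y = rhs x) \<and> (\<forall>x\<in>frontier B. ev v x = 0)"


section \<open>Tensorised Lagrange interpolation\<close>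

definition lagrange_basis :: "(nat \<Rightarrow> real) \<Rightarrow> nat \<Rightarrow> nat \<Rightarrow> real \<Rightarrow> real"
  where "lagrange_basis p M k t = (\<Prod>l\<in>{..<M} - {k}. (t - p l) / (p k - p l))"

definition lagrange_interp :: "(nat \<Rightarrow> real) \<Rightarrow> nat \<Rightarrow> (real \<Rightarrow> real) \<Rightarrow> real \<Rightarrow> real"
  where "lagrange_interp p M f t = (\<Sum>k<M. f (p k) * lagrange_basis p M k t)"

text \<open>In direction \<open>n\<close>, the rule with \<open>M\<close> points uses the points \<open>node n M k\<close> with \<open>k < M\<close>.\<close>

definition tensor_interp ::
  "('N::finite \<Rightarrow> nat \<Rightarrow> nat \<Rightarrow> real) \<Rightarrow> nat ^ 'N \<Rightarrow> (real ^ 'N \<Rightarrow> real) \<Rightarrow> real ^ 'N \<Rightarrow> real"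
  where "tensor_interp node M f y =
    (\<Sum>k\<in>{k. \<forall>n. k $ n < M $ n}.
       f (\<chi> n. node n (M $ n) (k $ n)) *
       (\<Prod>n\<in>UNIV. lagrange_basis (node n (M $ n)) (M $ n) (k $ n) (y $ n)))"

lemma vec_box_eq_image:
  "{k :: nat ^ 'N. \<forall>n. k $ n \<in> S n} = vec_lambda ` (PiE UNIV S)"
proof (intro equalityI subsetI)
  fix k :: "nat ^ 'N" assume "k \<in> {k. \<forall>n. k $ n \<in> S n}"
  then have "(\<lambda>n. k $ n) \<in> PiE UNIV S" by auto
  moreover have "k = vec_lambda (\<lambda>n. k $ n)" by simp
  ultimately show "k \<in> vec_lambda ` (PiE UNIV S)" by blast
qed auto

lemma finite_vec_box:
  fixes S :: "'N::finite \<Rightarrow> nat set"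
  assumes "\<And>n. finite (S n)"
  shows "finite {k :: nat ^ 'N. \<forall>n. k $ n \<in> S n}"
  unfolding vec_box_eq_image using assms by (intro finite_imageI finite_PiE) auto

text \<open>On product functions, \<^term>\<open>tensor_interp\<close> is the product of the univariate interpolants.\<close>

lemma tensor_interp_prod:
  fixes f :: "'N::finite \<Rightarrow> real \<Rightarrow> real"
  shows "tensor_interp node M (\<lambda>y. \<Prod>n\<in>UNIV. f n (y $ n)) y =
    (\<Prod>n\<in>UNIV. lagrange_interp (node n (M $ n)) (M $ n) (f n) (y $ n))"
proof -
  let ?g = "\<lambda>n k. f n (node n (M $ n) k) * lagrange_basis (node n (M $ n)) (M $ n) k (y $ n)"
  have "(\<Prod>n\<in>UNIV. lagrange_interp (node n (M $ n)) (M $ n) (f n) (y $ n)) =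
      (\<Prod>n\<in>UNIV. \<Sum>k\<in>{..<M $ n}. ?g n k)"
    by (simp add: lagrange_interp_def)
  also have "\<dots> = (\<Sum>k\<in>PiE UNIV (\<lambda>n. {..<M $ n}). \<Prod>n\<in>UNIV. ?g n (k n))"
    by (rule prod_sum_PiE) auto
  also have "\<dots> = (\<Sum>k\<in>vec_lambda ` (PiE UNIV (\<lambda>n. {..<M $ n})). \<Prod>n\<in>UNIV. ?g n (k $ n))"
    by (subst sum.reindex) (auto simp: inj_on_def vec_lambda_inject)
  also have "\<dots> = (\<Sum>k\<in>{k. \<forall>n. k $ n < M $ n}. \<Prod>n\<in>UNIV. ?g n (k $ n))"
    using vec_box_eq_image[of "\<lambda>n. {..<M $ n}"] by simp
  finally show ?thesis
    by (simp add: tensor_interp_def prod.distrib)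
qed


section \<open>Mixed differences and the estimator\<close>

text \<open>A multi-index of dimension \<open>D + N\<close> is a pair of a vector in \<^typ>\<open>nat ^ 'D\<close> and a
  vector in \<^typ>\<open>nat ^ 'N\<close>.\<close>

definition pos_ind :: "(nat ^ 'k) set"
  where "pos_ind = {v. \<forall>i. 1 \<le> v $ i}"

definition vec_total :: "nat ^ 'k \<Rightarrow> nat"
  where "vec_total v = (\<Sum>i\<in>UNIV. v $ i)"

definition binary_ind :: "(nat ^ 'k) set"
  where "binary_ind = {j. \<forall>i. j $ i \<in> {0, 1}}"

definition misc_approx ::
  "('N::finite \<Rightarrow> real set) \<Rightarrow> ('N \<Rightarrow> nat \<Rightarrow> nat \<Rightarrow> real) \<Rightarrow> (nat \<Rightarrow> nat) \<Rightarrow>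
   (nat ^ 'D \<Rightarrow> real ^ 'N \<Rightarrow> real) \<Rightarrow> nat ^ 'D \<Rightarrow> nat ^ 'N \<Rightarrow> real"
  where "misc_approx \<Gamma> node m Fdisc \<alpha> \<beta> =
    (if \<alpha> \<in> pos_ind \<and> \<beta> \<in> pos_ind
     then expect \<Gamma> (tensor_interp node (\<chi> n. m (\<beta> $ n)) (Fdisc \<alpha>)) else 0)"

text \<open>The truncation in the subtraction on \<^typ>\<open>nat\<close> has no effect at indices without zero
  components.\<close>

definition diff_det :: "(nat ^ 'D \<Rightarrow> nat ^ 'N \<Rightarrow> real) \<Rightarrow> nat ^ 'D \<Rightarrow> nat ^ 'N \<Rightarrow> real"
  where "diff_det G \<alpha> \<beta> = (\<Sum>j\<in>binary_ind. (-1) ^ vec_total j * G (\<alpha> - j) \<beta>)"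

definition diff_stoc :: "(nat ^ 'D \<Rightarrow> nat ^ 'N \<Rightarrow> real) \<Rightarrow> nat ^ 'D \<Rightarrow> nat ^ 'N \<Rightarrow> real"
  where "diff_stoc G \<alpha> \<beta> = (\<Sum>j\<in>binary_ind. (-1) ^ vec_total j * G \<alpha> (\<beta> - j))"

definition mixed_diff :: "(nat ^ 'D \<Rightarrow> nat ^ 'N \<Rightarrow> real) \<Rightarrow> nat ^ 'D \<Rightarrow> nat ^ 'N \<Rightarrow> real"
  where "mixed_diff G = diff_stoc (diff_det G)"

definition misc_estimator ::
  "(nat ^ 'D \<Rightarrow> nat ^ 'N \<Rightarrow> real) \<Rightarrow> ((nat ^ 'D) \<times> (nat ^ 'N)) set \<Rightarrow> real"
  where "misc_estimator G I = (\<Sum>(\<alpha>, \<beta>)\<in>I. mixed_diff G \<alpha> \<beta>)"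

definition error_contrib :: "(nat ^ 'D \<Rightarrow> nat ^ 'N \<Rightarrow> real) \<Rightarrow> nat ^ 'D \<Rightarrow> nat ^ 'N \<Rightarrow> real"
  where "error_contrib G \<alpha> \<beta> = \<bar>mixed_diff G \<alpha> \<beta>\<bar>"

definition misc_error ::
  "real \<Rightarrow> (nat ^ 'D \<Rightarrow> nat ^ 'N \<Rightarrow> real) \<Rightarrow> ((nat ^ 'D) \<times> (nat ^ 'N)) set \<Rightarrow> real"
  where "misc_error target G I = \<bar>target - misc_estimator G I\<bar>"

definition misc_work ::
  "(nat ^ 'D \<Rightarrow> nat ^ 'N \<Rightarrow> real) \<Rightarrow> ((nat ^ 'D) \<times> (nat ^ 'N)) set \<Rightarrow> real"
  where "misc_work dW I = (\<Sum>(\<alpha>, \<beta>)\<in>I. dW \<alpha> \<beta>)"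


section \<open>The optimised index sets\<close>

definition opt_index_set ::
  "('D::finite \<Rightarrow> real) \<Rightarrow> ('D \<Rightarrow> real) \<Rightarrow> ('N::finite \<Rightarrow> real) \<Rightarrow> real \<Rightarrow> real \<Rightarrow>
   ((nat ^ 'D) \<times> (nat ^ 'N)) set"
  where "opt_index_set r \<gamma> g \<delta> L = {(\<alpha>, \<beta>). \<alpha> \<in> pos_ind \<and> \<beta> \<in> pos_ind \<and>
    (\<Sum>i\<in>UNIV. (r i + \<gamma> i) * real (\<alpha> $ i)) +
    (\<Sum>j\<in>UNIV. \<delta> * real (\<beta> $ j) + g j * exp (\<delta> * real (\<beta> $ j))) \<le> L}"

definition level_of_work :: "real \<Rightarrow> nat \<Rightarrow> real \<Rightarrow> real \<Rightarrow> real"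
  where "level_of_work c z C W =
    1 / c * (ln (W / C) - (real z - 1) * ln (1 / c * ln (W / C)))"

text \<open>The sums over \<^term>\<open>opt_index_set r \<gamma> g \<delta> L\<close> are finite sums.\<close>

lemma finite_opt_index_set:
  fixes r \<gamma> :: "'D::finite \<Rightarrow> real" and g :: "'N::finite \<Rightarrow> real"
  assumes "\<And>i. 0 < r i + \<gamma> i" and "\<And>j. 0 \<le> g j" and "0 < \<delta>"
  shows "finite (opt_index_set r \<gamma> g \<delta> L)"
proof -
  let ?A = "{\<alpha> :: nat ^ 'D. \<forall>i. \<alpha> $ i \<in> {.. nat \<lfloor>L / (r i + \<gamma> i)\<rfloor>}}"
  let ?B = "{\<beta> :: nat ^ 'N. \<forall>j. \<beta> $ j \<in> {.. nat \<lfloor>L / \<delta>\<rfloor>}}"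
  have "opt_index_set r \<gamma> g \<delta> L \<subseteq> ?A \<times> ?B"
  proof clarify
    fix \<alpha> :: "nat ^ 'D" and \<beta> :: "nat ^ 'N"
    assume ab: "(\<alpha>, \<beta>) \<in> opt_index_set r \<gamma> g \<delta> L"
    let ?a = "\<lambda>i. (r i + \<gamma> i) * real (\<alpha> $ i)"
    let ?b = "\<lambda>j. \<delta> * real (\<beta> $ j) + g j * exp (\<delta> * real (\<beta> $ j))"
    have a0: "0 \<le> ?a i" for i using assms(1)[of i] by simp
    have b0: "\<delta> * real (\<beta> $ j) \<le> ?b j" "0 \<le> ?b j" for j using assms(2)[of j] assms(3) by simp_all
    have le: "sum ?a UNIV + sum ?b UNIV \<le> L" using ab by (simp add: opt_index_set_def)
    have "\<alpha> $ i \<le> nat \<lfloor>L / (r i + \<gamma> i)\<rfloor>" for i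
    proof -
      have "?a i \<le> sum ?a UNIV" by (rule member_le_sum) (use a0 in auto)
      moreover have "0 \<le> sum ?b UNIV" by (rule sum_nonneg) (use b0 in auto)
      ultimately have "real (\<alpha> $ i) \<le> L / (r i + \<gamma> i)"
        using le assms(1)[of i] by (simp add: field_simps)
      then show ?thesis by (simp add: le_nat_floor)
    qed
    moreover have "\<beta> $ j \<le> nat \<lfloor>L / \<delta>\<rfloor>" for j
    proof -
      have "?b j \<le> sum ?b UNIV" by (rule member_le_sum) (use b0 in auto)
      moreover have "0 \<le> sum ?a UNIV" by (rule sum_nonneg) (use a0 in auto)
      ultimately have "\<delta> * real (\<beta> $ j) \<le> L" using le b0(1)[of j] by linarith
      then have "real (\<beta> $ j) \<le> L / \<delta>" using assms(3) by (simp add: field_simps)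
      then show ?thesis by (simp add: le_nat_floor)
    qed
    ultimately show "\<alpha> \<in> ?A \<and> \<beta> \<in> ?B" by simp
  qed
  moreover have "finite (?A \<times> ?B)" by (intro finite_cartesian_product finite_vec_box) auto
  ultimately show ?thesis by (rule finite_subset)
qed

end

theory Submission
  imports Defs "HOL-Real_Asymp.Real_Asymp"
begin

text \<open>Write \<open>s\<close> for the quantity bounded by \<open>L\<close> in the definition of the index set and \<open>t\<close> for the
  logarithm of the work bound, so that work and error contributions are at most multiples of
  \<open>exp t\<close> and \<open>exp (t - s)\<close>. In every coordinate \<open>t \<le> \<chi> s\<close> up to a summable factor
  \<open>exp (t - \<chi> s)\<close>, except in the \<open>z\<close> critical directions, where \<open>t = \<chi> s\<close>. Summing one critical
  coordinate as a geometric series gives \<open>exp (\<chi> L)\<close>, and each of the other \<open>z - 1\<close> critical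
  coordinates takes \<open>O(L)\<close> values; so the work is \<open>O(exp (\<chi> L) L ^ (z - 1))\<close>. Cutting the complement
  into shells of unit width in \<open>s\<close> and using the work estimate in each shell bounds the error by
  \<open>O(exp (- (1 - \<chi>) L) L ^ (z - 1))\<close>. The choice of \<open>L\<close> makes \<open>exp (\<chi> L)\<close> equal to
  \<open>W / C\<close> divided by the power \<open>z - 1\<close> of \<open>ln (W / C) / \<chi> \<ge> L\<close>, and \<open>1 - \<chi> = \<chi> \<zeta>\<close>.\<close>

section \<open>Exponential sums over weighted simplices\<close>

text \<open>A geometric sum with ratio above 1 is at most a constant times its largest term, and the
  constant depends only on \<open>a\<close>.\<close>

lemma sum_exp_multiples_le:
  fixes a S :: real and A :: "nat set"
  assumes a: "0 < a" and A: "finite A" "\<And>n. n \<in> A \<Longrightarrow> a * real n \<le> S"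
  shows "(\<Sum>n\<in>A. exp (a * real n)) \<le> exp a / (exp a - 1) * exp S"
proof (cases "A = {}")
  case True
  then show ?thesis using a by simp
next
  case False
  define M where "M = Max A"
  have M: "M \<in> A" unfolding M_def using A(1) False by simp
  have q: "1 < exp a" using a by simp
  have "(\<Sum>n\<in>A. exp (a * real n)) \<le> (\<Sum>n\<le>M. exp (a * real n))"
    using A(1) by (intro sum_mono2) (auto simp: M_def)
  also have "\<dots> = (\<Sum>n\<le>M. exp a ^ n)"
    by (intro sum.cong refl) (metis exp_of_nat_mult mult.commute)
  also have "\<dots> = (exp a ^ Suc M - 1) / (exp a - 1)"
    using q geometric_sum[of "exp a" "Suc M"] by (simp add: lessThan_Suc_atMost)
  also have "\<dots> \<le> exp a ^ Suc M / (exp a - 1)"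
    using q by (intro divide_right_mono) auto
  also have "\<dots> = exp a / (exp a - 1) * exp (a * real M)"
    by (simp add: exp_of_nat_mult[symmetric] mult.commute)
  also have "\<dots> \<le> exp a / (exp a - 1) * exp S"
    using A(2)[OF M] q by (intro mult_left_mono) auto
  finally show ?thesis .
qed

text \<open>Erase one critical coordinate \<open>i\<close>. For fixed values of the others the sum
  is geometric in \<open>x i\<close> and costs \<open>exp (c * L)\<close>. What remains factorises
  over a box, where a critical coordinate contributes its number of values and a noncritical one a
  convergent series.\<close>

lemma weighted_simplex_sum_bound:
  fixes s t :: "'k::finite \<Rightarrow> nat \<Rightarrow> real" and w :: "'k \<Rightarrow> real" and c :: real
  assumes c: "0 < c" and Z: "Z \<noteq> {}"
    and crit: "\<And>k n. k \<in> Z \<Longrightarrow> 0 < w k \<and> s k n = w k * real n \<and> t k n = c * (w k * real n)"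
    and s_nonneg: "\<And>k n. 0 \<le> s k n"
    and noncrit: "\<And>k. k \<notin> Z \<Longrightarrow> summable (\<lambda>n. exp (t k n - c * s k n))"
  obtains K where "0 < K"
    and "\<And>L A. 0 \<le> L \<Longrightarrow> finite A \<Longrightarrow> A \<subseteq> {x. (\<forall>k. 1 \<le> x k) \<and> (\<Sum>k\<in>UNIV. s k (x k)) \<le> L} \<Longrightarrow>
      (\<Sum>x\<in>A. exp (\<Sum>k\<in>UNIV. t k (x k))) \<le> K * exp (c * L) * (1 + L) ^ (card Z - 1)"
proof -
  obtain i where i: "i \<in> Z" using Z by auto
  define q where "q = exp (c * w i) / (exp (c * w i) - 1)"
  define e where "e k n = exp (t k n - c * s k n)" for k n
  \<comment> \<open>The share of coordinate \<open>k\<close> in the constant: 1 for the erased one,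
    the density \<open>1 / w k\<close> of values for the other critical ones, the full series
    otherwise.\<close>
  define V where "V k = (if k \<in> Z then if k = i then 1 else 1 / w k else suminf (e k))" for k
  have wi: "0 < c * w i" using crit[OF i] c by simp
  have q: "0 < q" using wi by (simp add: q_def)
  have e_pos: "0 < e k n" for k n by (simp add: e_def)
  have e_crit: "e k n = 1" if "k \<in> Z" for k n using crit[OF that] by (simp add: e_def)
  have e_summable: "summable (e k)" if "k \<notin> Z" for k
    using noncrit[OF that] unfolding e_def [abs_def] .
  have V_pos: "0 < V k" for k
  proof (cases "k \<in> Z")
    case True
    then show ?thesis using crit[OF True] by (simp add: V_def)
  next
    case False
    then show ?thesis using e_summable e_pos by (simp add: V_def suminf_pos)
  qed
  show thesis
  proof (rule that)
    show "0 < q * prod V UNIV" using q V_pos by (simp add: prod_pos)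
  next
    fix L :: real and A :: "('k \<Rightarrow> nat) set"
    assume L: "0 \<le> L" and A: "finite A"
      and AP: "A \<subseteq> {x. (\<forall>k. 1 \<le> x k) \<and> (\<Sum>k\<in>UNIV. s k (x k)) \<le> L}"
    \<comment> \<open>Resetting coordinate \<open>i\<close> to 0 is harmless: \<open>s i\<close>
      vanishes there and \<open>e i\<close> is constantly 1.\<close>
    define P :: "('k \<Rightarrow> nat) \<Rightarrow> 'k \<Rightarrow> nat" where "P x = x(i := 0)" for x
    \<comment> \<open>A bound on \<open>s\<close> need not bound a noncritical coordinate, so the
      cut-off is read off the finite set \<open>A\<close>; the inserted 0 covers
      \<open>A = {}\<close>.\<close>
    define M where "M = Max (insert 0 ((\<lambda>(x, k). x k) ` (A \<times> UNIV)))"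
    \<comment> \<open>Critical ranges start at 1, so they have at most \<open>L / w k\<close>
      elements; an additional element could exceed \<open>(1 + L) / w k\<close>.\<close>
    define B where "B k = (if k \<in> Z then if k = i then {0} else {1..nat \<lfloor>L / w k\<rfloor>} else {..M})" for k
    have M: "x k \<le> M" if "x \<in> A" for x k
      unfolding M_def using A that by (intro Max_ge) force+
    have sum_s: "(\<Sum>k\<in>UNIV. s k (x k)) = w i * real (x i) + (\<Sum>k\<in>UNIV. s k (P x k))" for x
    proof -
      have "(\<Sum>k\<in>UNIV - {i}. s k (x k)) = (\<Sum>k\<in>UNIV - {i}. s k (P x k))"
        by (intro sum.cong) (auto simp: P_def)
      then show ?thesis
        using crit[OF i] by (simp add: sum.remove[of UNIV i] P_def)
    qed
    have prod_e: "(\<Prod>k\<in>UNIV. e k (x k)) = (\<Prod>k\<in>UNIV. e k (P x k))" for x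
      by (intro prod.cong) (auto simp: P_def e_crit[OF i])
    have exp_t: "exp (\<Sum>k\<in>UNIV. t k (x k)) = exp (c * (\<Sum>k\<in>UNIV. s k (x k))) * (\<Prod>k\<in>UNIV. e k (P x k))" for x
    proof -
      have "(\<Prod>k\<in>UNIV. e k (x k)) = exp (\<Sum>k\<in>UNIV. t k (x k) - c * s k (x k))"
        by (simp add: e_def exp_sum)
      also have "\<dots> = exp ((\<Sum>k\<in>UNIV. t k (x k)) - c * (\<Sum>k\<in>UNIV. s k (x k)))"
        by (simp add: sum_subtractf sum_distrib_left)
      finally show ?thesis by (simp add: prod_e[symmetric] exp_add[symmetric])
    qed
    \<comment> \<open>The bound is uniform in \<open>y\<close>: the weight \<open>\<sigma>\<close>
      of the fixed coordinates cancels against the room \<open>L - \<sigma>\<close> left for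
      coordinate \<open>i\<close>.\<close>
    have fibre: "(\<Sum>x | x \<in> A \<and> P x = y. exp (c * (\<Sum>k\<in>UNIV. s k (x k)))) \<le> q * exp (c * L)" for y
    proof -
      define \<sigma> where "\<sigma> = (\<Sum>k\<in>UNIV. s k (y k))"
      let ?F = "{x \<in> A. P x = y}"
      have inj: "inj_on (\<lambda>x. x i) ?F"
      proof (rule inj_onI)
        fix x x' assume x: "x \<in> ?F" "x' \<in> ?F" "x i = x' i"
        have "x(i := 0) = x'(i := 0)" using x by (simp add: P_def)
        then have "(x(i := 0))(i := x i) = (x'(i := 0))(i := x' i)" using x(3) by (simp only:)
        then show "x = x'" by simp
      qed
      have "(\<Sum>x\<in>?F. exp (c * (\<Sum>k\<in>UNIV. s k (x k)))) = (\<Sum>x\<in>?F. exp (c * \<sigma>) * exp (c * w i * real (x i)))"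
      proof (rule sum.cong)
        fix x assume "x \<in> ?F"
        then have "(\<Sum>k\<in>UNIV. s k (x k)) = w i * real (x i) + \<sigma>"
          using sum_s[of x] by (simp add: \<sigma>_def)
        then show "exp (c * (\<Sum>k\<in>UNIV. s k (x k))) = exp (c * \<sigma>) * exp (c * w i * real (x i))"
          by (simp add: exp_add[symmetric] algebra_simps)
      qed simp
      also have "\<dots> = exp (c * \<sigma>) * (\<Sum>n\<in>(\<lambda>x. x i) ` ?F. exp (c * w i * real n))"
        by (simp add: sum.reindex[OF inj] sum_distrib_left)
      also have "\<dots> \<le> exp (c * \<sigma>) * (q * exp (c * (L - \<sigma>)))"
        unfolding q_def
      proof (intro mult_left_mono sum_exp_multiples_le[OF wi])
        fix n assume "n \<in> (\<lambda>x. x i) ` ?F"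
        then obtain x where x: "x \<in> A" "P x = y" "n = x i" by auto
        then have "w i * real n + \<sigma> \<le> L" using AP sum_s[of x] by (auto simp: \<sigma>_def)
        then have "c * (w i * real n) \<le> c * (L - \<sigma>)" using c by (intro mult_left_mono) auto
        then show "c * w i * real n \<le> c * (L - \<sigma>)" by (simp add: mult.assoc)
      qed (use A in auto)
      also have "\<dots> = q * exp (c * L)" by (simp add: exp_add[symmetric] algebra_simps)
      finally show ?thesis .
    qed
    have PB: "P ` A \<subseteq> PiE UNIV B"
    proof clarify
      fix x assume x: "x \<in> A"
      have "P x k \<in> B k" for k
      proof (cases "k \<in> Z \<and> k \<noteq> i")
        case True
        have "s k (x k) \<le> (\<Sum>k\<in>UNIV. s k (x k))"
          by (rule member_le_sum) (auto simp: s_nonneg)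
        also have "\<dots> \<le> L" using AP x by blast
        finally have "w k * real (x k) \<le> L" "0 < w k" using True crit[of k "x k"] by simp_all
        then have "real (x k) \<le> L / w k" by (simp add: field_simps)
        moreover have "1 \<le> x k" using AP x by blast
        ultimately show ?thesis using True by (simp add: B_def P_def le_nat_floor)
      next
        case False
        then show ?thesis using M[OF x, of k] i by (cases "k = i") (simp_all add: B_def P_def)
      qed
      then show "P x \<in> PiE UNIV B" by auto
    qed
    have sumB: "(\<Sum>n\<in>B k. e k n) \<le> V k * (if k \<in> Z - {i} then 1 + L else 1)" for k
    proof (cases "k \<in> Z")
      case True
      show ?thesis
      proof (cases "k = i")
        case True
        then show ?thesis using i by (simp add: B_def V_def e_crit)
      next
        case False
        have w: "0 < w k" using crit[OF True] by blast
        then have "0 \<le> L / w k" using L by simp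
        then have "real (nat \<lfloor>L / w k\<rfloor>) \<le> (1 + L) / w k"
          using w of_nat_floor[of "L / w k"] by (simp add: add_divide_distrib add_increasing)
        then show ?thesis using True False by (simp add: B_def V_def e_crit)
      qed
    next
      case False
      have "sum (e k) {..M} \<le> suminf (e k)"
        using e_summable[OF False] e_pos by (intro sum_le_suminf) (auto intro: less_imp_le)
      then show ?thesis using False i by (simp add: B_def V_def)
    qed
    have "(\<Sum>x\<in>A. exp (\<Sum>k\<in>UNIV. t k (x k))) =
      (\<Sum>y\<in>P ` A. \<Sum>x | x \<in> A \<and> P x = y. exp (c * (\<Sum>k\<in>UNIV. s k (x k))) * (\<Prod>k\<in>UNIV. e k (P x k)))"
      using A by (subst sum.image_gen[of A _ P]) (simp_all add: exp_t)
    also have "\<dots> = (\<Sum>y\<in>P ` A. (\<Sum>x | x \<in> A \<and> P x = y. exp (c * (\<Sum>k\<in>UNIV. s k (x k)))) * (\<Prod>k\<in>UNIV. e k (y k)))"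
      unfolding sum_distrib_right by (intro sum.cong) auto
    also have "\<dots> \<le> (\<Sum>y\<in>P ` A. q * exp (c * L) * (\<Prod>k\<in>UNIV. e k (y k)))"
      using e_pos by (intro sum_mono mult_right_mono fibre) (simp add: prod_nonneg less_imp_le)
    also have "\<dots> = q * exp (c * L) * (\<Sum>y\<in>P ` A. \<Prod>k\<in>UNIV. e k (y k))"
      by (simp add: sum_distrib_left)
    also have "\<dots> \<le> q * exp (c * L) * (\<Sum>y\<in>PiE UNIV B. \<Prod>k\<in>UNIV. e k (y k))"
      using e_pos q PB
      by (intro mult_left_mono sum_mono2)
        (auto intro!: finite_PiE simp: B_def prod_nonneg less_imp_le)
    also have "\<dots> = q * exp (c * L) * (\<Prod>k\<in>UNIV. \<Sum>n\<in>B k. e k n)"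
      by (subst prod_sum_PiE) (auto simp: B_def)
    also have "\<dots> \<le> q * exp (c * L) * (\<Prod>k\<in>UNIV. V k * (if k \<in> Z - {i} then 1 + L else 1))"
      using q e_pos by (intro mult_left_mono prod_mono conjI sumB sum_nonneg) (auto intro: less_imp_le)
    also have "(\<Prod>k\<in>UNIV. V k * (if k \<in> Z - {i} then 1 + L else 1)) = prod V UNIV * (1 + L) ^ (card Z - 1)"
      using prod.inter_restrict[of UNIV "\<lambda>_. 1 + L" "Z - {i}"] i
      by (simp only: prod.distrib prod_constant finite Int_UNIV_left card_Diff_singleton)
    finally show "(\<Sum>x\<in>A. exp (\<Sum>k\<in>UNIV. t k (x k))) \<le> q * prod V UNIV * exp (c * L) * (1 + L) ^ (card Z - 1)"
      by (simp add: mult_ac)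
  qed
qed

text \<open>Half of the exponential rate absorbs the polynomial factor.\<close>

lemma summable_power_times_geometric:
  fixes q :: real
  assumes "0 < q"
  shows "summable (\<lambda>n. exp (- q * real n) * real (n + 2) ^ p)"
proof (rule summable_comparison_test_bigo)
  show "summable (\<lambda>n. norm (exp (- q / 2) ^ n))"
    using assms by (simp add: summable_geometric)
  show "(\<lambda>n. exp (- q * real n) * real (n + 2) ^ p) \<in> O(\<lambda>n. exp (- q / 2) ^ n)"
    using assms by real_asymp
qed

text \<open>On the shell with \<open>S\<close> between \<open>L + n\<close> and
  \<open>L + n + 1\<close>, replace \<open>exp (- S x)\<close> by \<open>exp (- (L + n))\<close> and
  apply \<open>bound\<close> at the outer level. The growth rate \<open>c < 1\<close> loses against
  the decay rate 1, so the shells form a convergent series in \<open>n\<close>. Finite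
  \<open>A\<close> suffices because the error is later reached as a limit of finite sums.\<close>

lemma tail_sum_bound:
  fixes S T :: "'a \<Rightarrow> real" and c K :: real
  assumes c: "0 < c" "c < 1" and K: "0 < K"
    and fin: "\<And>L. finite {x \<in> X. S x \<le> L}"
    and bound: "\<And>L. 0 \<le> L \<Longrightarrow> (\<Sum>x | x \<in> X \<and> S x \<le> L. exp (T x)) \<le> K * exp (c * L) * (1 + L) ^ p"
  obtains K' where "0 < K'"
    and "\<And>L A. 0 \<le> L \<Longrightarrow> finite A \<Longrightarrow> A \<subseteq> {x \<in> X. L < S x} \<Longrightarrow>
      (\<Sum>x\<in>A. exp (T x - S x)) \<le> K' * exp (- (1 - c) * L) * (1 + L) ^ p"
proof -
  \<comment> \<open>The shift by 2 comes from
    \<open>1 + (L + n + 1) \<le> (1 + L) * (n + 2)\<close>, which separates \<open>n\<close> from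
    \<open>L\<close>.\<close>
  define d where "d n = exp (- (1 - c) * real n) * real (n + 2) ^ p" for n
  have d: "summable d" "\<And>n. 0 < d n"
    using summable_power_times_geometric[of "1 - c" p] c by (simp_all add: d_def [abs_def])
  show thesis
  proof (rule that)
    show "0 < K * exp c * suminf d" using K d suminf_pos[of d] by simp
  next
    fix L A assume L: "0 \<le> L" and A: "finite A" and AX: "A \<subseteq> {x \<in> X. L < S x}"
    define \<nu> where "\<nu> x = nat \<lfloor>S x - L\<rfloor>" for x
    have \<nu>: "L + real (\<nu> x) \<le> S x" "S x \<le> L + real (\<nu> x) + 1" if "x \<in> A" for x
    proof -
      have "L < S x" using AX that by auto
      then show "L + real (\<nu> x) \<le> S x" "S x \<le> L + real (\<nu> x) + 1" unfolding \<nu>_def by linarith+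
    qed
    have shell: "(\<Sum>x | x \<in> A \<and> \<nu> x = n. exp (T x - S x)) \<le> K * exp c * exp (- (1 - c) * L) * (1 + L) ^ p * d n" for n
    proof -
      have "(\<Sum>x | x \<in> A \<and> \<nu> x = n. exp (T x - S x)) \<le> (\<Sum>x | x \<in> A \<and> \<nu> x = n. exp (- (L + n)) * exp (T x))"
      proof (rule sum_mono)
        fix x assume x: "x \<in> {x. x \<in> A \<and> \<nu> x = n}"
        then have "T x - S x \<le> - (L + n) + T x" using \<nu>(1)[of x] by simp
        then show "exp (T x - S x) \<le> exp (- (L + n)) * exp (T x)" by (simp only: exp_add[symmetric] exp_le_cancel_iff)
      qed
      also have "\<dots> = exp (- (L + n)) * (\<Sum>x | x \<in> A \<and> \<nu> x = n. exp (T x))"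
        by (simp add: sum_distrib_left)
      also have "\<dots> \<le> exp (- (L + n)) * (\<Sum>x | x \<in> X \<and> S x \<le> L + n + 1. exp (T x))"
        using \<nu>(2) AX by (intro mult_left_mono sum_mono2 fin) auto
      also have "\<dots> \<le> exp (- (L + n)) * (K * exp (c * (L + n + 1)) * (1 + (L + n + 1)) ^ p)"
        using L by (intro mult_left_mono bound) auto
      also have "\<dots> = K * exp c * exp (- (1 - c) * L) * exp (- (1 - c) * n) * (L + real (n + 2)) ^ p"
        by (simp add: exp_add[symmetric] exp_minus exp_diff algebra_simps) (simp add: field_simps flip: exp_add)
      also have "\<dots> \<le> K * exp c * exp (- (1 - c) * L) * exp (- (1 - c) * n) * ((1 + L) * real (n + 2)) ^ p"
        using K L by (intro mult_left_mono power_mono) (auto simp: algebra_simps)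
      also have "\<dots> = K * exp c * exp (- (1 - c) * L) * (1 + L) ^ p * d n"
        by (simp add: d_def power_mult_distrib)
      finally show ?thesis .
    qed
    have "(\<Sum>x\<in>A. exp (T x - S x)) = (\<Sum>n\<in>\<nu> ` A. \<Sum>x | x \<in> A \<and> \<nu> x = n. exp (T x - S x))"
      using A by (rule sum.image_gen)
    also have "\<dots> \<le> (\<Sum>n\<in>\<nu> ` A. K * exp c * exp (- (1 - c) * L) * (1 + L) ^ p * d n)"
      by (intro sum_mono shell)
    also have "\<dots> = K * exp c * exp (- (1 - c) * L) * (1 + L) ^ p * (\<Sum>n\<in>\<nu> ` A. d n)"
      by (simp add: sum_distrib_left)
    also have "\<dots> \<le> K * exp c * exp (- (1 - c) * L) * (1 + L) ^ p * suminf d"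
      using K L A d by (intro mult_left_mono sum_le_suminf) (auto intro: less_imp_le)
    finally show "(\<Sum>x\<in>A. exp (T x - S x)) \<le> K * exp c * suminf d * exp (- (1 - c) * L) * (1 + L) ^ p"
      by (simp add: mult_ac)
  qed
qed


section \<open>Work and error of the optimised index sets\<close>

text \<open>Up to constants, the logarithm of the work bound divided by the error bound: the index
  set keeps the indices of largest profit.\<close>

definition index_cost ::
  "('D::finite \<Rightarrow> real) \<Rightarrow> ('D \<Rightarrow> real) \<Rightarrow> ('N::finite \<Rightarrow> real) \<Rightarrow> real \<Rightarrow> (nat ^ 'D) \<times> (nat ^ 'N) \<Rightarrow> real"
  where "index_cost r \<gamma> g \<delta> x = (\<Sum>i\<in>UNIV. (r i + \<gamma> i) * real (fst x $ i)) +
    (\<Sum>j\<in>UNIV. \<delta> * real (snd x $ j) + g j * exp (\<delta> * real (snd x $ j)))"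

definition log_work ::
  "('D::finite \<Rightarrow> real) \<Rightarrow> real \<Rightarrow> (nat ^ 'D) \<times> (nat ^ 'N::finite) \<Rightarrow> real"
  where "log_work \<gamma> \<delta> x = (\<Sum>i\<in>UNIV. \<gamma> i * real (fst x $ i)) + \<delta> * real (vec_total (snd x))"

lemma opt_index_set_eq:
  "opt_index_set r \<gamma> g \<delta> L = {x \<in> pos_ind \<times> pos_ind. index_cost r \<gamma> g \<delta> x \<le> L}"
  by (auto simp: opt_index_set_def index_cost_def)

lemma exp_log_work:
  "exp (log_work \<gamma> \<delta> (\<alpha>, \<beta>)) = exp (\<Sum>i\<in>UNIV. \<gamma> i * real (\<alpha> $ i)) * exp (\<delta> * real (vec_total \<beta>))"
  by (simp add: log_work_def exp_add)

lemma exp_log_work_minus_cost: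
  "exp (log_work \<gamma> \<delta> (\<alpha>, \<beta>) - index_cost r \<gamma> g \<delta> (\<alpha>, \<beta>)) =
    exp (- (\<Sum>i\<in>UNIV. r i * real (\<alpha> $ i))) * exp (- (\<Sum>j\<in>UNIV. g j * exp (\<delta> * real (\<beta> $ j))))"
  by (simp add: log_work_def index_cost_def vec_total_def exp_add[symmetric] algebra_simps
      sum.distrib sum_distrib_left)

lemma sum_UNIV_Plus:
  "(\<Sum>k\<in>UNIV. f k) = (\<Sum>i\<in>UNIV. f (Inl i)) + (\<Sum>j\<in>UNIV. f (Inr j))"
  for f :: "'a::finite + 'b::finite \<Rightarrow> real"
  by (simp add: sum.Plus comp_def flip: UNIV_Plus_UNIV)

text \<open>The doubly exponential decay beats the growth \<open>y = exp (\<delta> * n)\<close>. The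
  quadratic bound \<open>v\<^sup>2 / 2 \<le> exp v\<close> at \<open>v = c * g * y\<close> already
  leaves a multiple of \<open>1 / y\<close>, a geometric term.\<close>

lemma summable_stochastic_factor:
  fixes c g \<delta> :: real
  assumes c: "0 < c" and g: "0 < g" and \<delta>: "0 < \<delta>"
  shows "summable (\<lambda>n. exp (\<delta> * real n - c * (\<delta> * real n + g * exp (\<delta> * real n))))"
proof (rule summable_comparison_test)
  show "summable (\<lambda>n. 2 / (c * g)\<^sup>2 * exp (- \<delta>) ^ n)"
    using \<delta> by (intro summable_mult summable_geometric) simp
  have "exp (\<delta> * real n - c * (\<delta> * real n + g * exp (\<delta> * real n))) \<le> 2 / (c * g)\<^sup>2 * exp (- \<delta>) ^ n" for n
  proof -
    define y where "y = exp (\<delta> * real n)"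
    have y: "0 < y" by (simp add: y_def)
    define v where "v = c * g * y"
    have v: "0 < v" using y c g by (simp add: v_def)
    have "v\<^sup>2 / 2 \<le> exp v" using exp_lower_Taylor_quadratic[of v] v by simp
    then have "exp (- v) \<le> 2 / v\<^sup>2" using v by (simp add: exp_minus field_simps)
    have "exp (\<delta> * real n - c * (\<delta> * real n + g * y)) \<le> exp (\<delta> * real n - v)"
      using c \<delta> by (simp add: v_def algebra_simps)
    also have "\<dots> = y * exp (- v)" by (simp add: y_def exp_add[symmetric])
    also have "\<dots> \<le> y * (2 / v\<^sup>2)" using y \<open>exp (- v) \<le> 2 / v\<^sup>2\<close> by (intro mult_left_mono) auto
    also have "\<dots> = 2 / (c * g)\<^sup>2 * (1 / y)" using y by (simp add: v_def power2_eq_square)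
    also have "1 / y = exp (- \<delta>) ^ n"
      using exp_of_nat_mult[of n "- \<delta>"] by (simp add: y_def exp_minus inverse_eq_divide mult.commute)
    finally show ?thesis by (simp add: y_def)
  qed
  then show "\<exists>N. \<forall>n\<ge>N. norm (exp (\<delta> * real n - c * (\<delta> * real n + g * exp (\<delta> * real n)))) \<le> 2 / (c * g)\<^sup>2 * exp (- \<delta>) ^ n"
    by auto
qed

text \<open>Instance of the simplex bound with coordinates indexed by the sum type
  \<open>'D + 'N\<close>. Only deterministic directions can be critical; the stochastic ones are
  summable through their doubly exponential cost.\<close>

lemma work_sum_bound:
  fixes r \<gamma> :: "'D::finite \<Rightarrow> real" and g :: "'N::finite \<Rightarrow> real"
  assumes r: "\<And>i. 0 < r i" and \<gamma>: "\<And>i. 0 < \<gamma> i" and g: "\<And>j. 0 < g j" and \<delta>: "0 < \<delta>"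
    and c: "0 < c" "\<And>i. \<gamma> i \<le> c * (r i + \<gamma> i)"
    and Z: "Z = {i. \<gamma> i = c * (r i + \<gamma> i)}" "Z \<noteq> {}"
  obtains K where "0 < K"
    and "\<And>L. 0 \<le> L \<Longrightarrow>
      (\<Sum>x\<in>opt_index_set r \<gamma> g \<delta> L. exp (log_work \<gamma> \<delta> x)) \<le> K * exp (c * L) * (1 + L) ^ (card Z - 1)"
proof -
  define s where "s = case_sum (\<lambda>i n. (r i + \<gamma> i) * real n) (\<lambda>j n. \<delta> * real n + g j * exp (\<delta> * real n))"
  define t where "t = case_sum (\<lambda>i n. \<gamma> i * real n) (\<lambda>(j::'N) n. \<delta> * real n)"
  \<comment> \<open>Reads a pair of vectors as one function on the disjoint union of the
    directions.\<close>
  define \<iota> :: "(nat ^ 'D) \<times> (nat ^ 'N) \<Rightarrow> 'D + 'N \<Rightarrow> nat"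
    where "\<iota> x = case_sum (($) (fst x)) (($) (snd x))" for x
  have inj: "inj \<iota>"
  proof (rule injI)
    fix x y assume "\<iota> x = \<iota> y"
    then have "\<iota> x (Inl i) = \<iota> y (Inl i)" "\<iota> x (Inr j) = \<iota> y (Inr j)" for i j by simp_all
    then show "x = y" by (simp add: \<iota>_def prod_eq_iff vec_eq_iff)
  qed
  have cost: "(\<Sum>k\<in>UNIV. s k (\<iota> x k)) = index_cost r \<gamma> g \<delta> x" for x
    by (simp add: sum_UNIV_Plus s_def \<iota>_def index_cost_def)
  have work: "(\<Sum>k\<in>UNIV. t k (\<iota> x k)) = log_work \<gamma> \<delta> x" for x
    by (simp add: sum_UNIV_Plus t_def \<iota>_def log_work_def vec_total_def sum_distrib_left)
  have pos: "0 < r i + \<gamma> i" for i using r \<gamma> by (simp add: add_pos_pos)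
  have card: "card (Inl ` Z :: ('D + 'N) set) = card Z" by (simp add: card_image)
  obtain K where "0 < K" and K: "\<And>L A. 0 \<le> L \<Longrightarrow> finite A \<Longrightarrow>
      A \<subseteq> {x. (\<forall>k. 1 \<le> x k) \<and> (\<Sum>k\<in>UNIV. s k (x k)) \<le> L} \<Longrightarrow>
      (\<Sum>x\<in>A. exp (\<Sum>k\<in>UNIV. t k (x k))) \<le> K * exp (c * L) * (1 + L) ^ (card Z - 1)"
  proof (rule weighted_simplex_sum_bound[where c = c and s = s and t = t and Z = "Inl ` Z"
        and w = "case_sum (\<lambda>i. r i + \<gamma> i) (\<lambda>j::'N. 0)"])
    fix k :: "'D + 'N" and n
    show "0 < case_sum (\<lambda>i. r i + \<gamma> i) (\<lambda>j. 0) k \<and>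
         s k n = case_sum (\<lambda>i. r i + \<gamma> i) (\<lambda>j. 0) k * real n \<and>
         t k n = c * (case_sum (\<lambda>i. r i + \<gamma> i) (\<lambda>j. 0) k * real n)"
      if "k \<in> Inl ` Z"
      using that pos by (auto simp: Z s_def t_def)
    show "0 \<le> s k n"
      using pos[THEN less_imp_le] g[THEN less_imp_le] \<delta> by (cases k) (simp_all add: s_def)
  next
    fix k :: "'D + 'N" assume k: "k \<notin> Inl ` Z"
    show "summable (\<lambda>n. exp (t k n - c * s k n))"
    proof (cases k)
      case (Inl i)
      define q where "q = c * (r i + \<gamma> i) - \<gamma> i"
      have "0 < q" using k c(2)[of i] by (auto simp: Inl Z q_def image_iff)
      have "exp (t k n - c * s k n) = exp (- q) ^ n" for n
        by (simp add: Inl s_def t_def q_def exp_of_nat_mult[symmetric] algebra_simps)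
      then show ?thesis using \<open>0 < q\<close> by (simp add: summable_geometric)
    next
      case (Inr j)
      then show ?thesis using summable_stochastic_factor[OF c(1) g \<delta>] by (simp add: s_def t_def)
    qed
  qed (use c Z card in auto)
  show thesis
  proof (rule that)
    show "0 < K" by fact
  next
    fix L :: real assume L: "0 \<le> L"
    let ?I = "opt_index_set r \<gamma> g \<delta> L"
    have fin: "finite ?I"
      using pos g \<delta> by (intro finite_opt_index_set) (auto intro: less_imp_le)
    have "1 \<le> \<iota> x k" if "x \<in> ?I" for x k
      using that by (cases k) (auto simp: \<iota>_def pos_ind_def opt_index_set_eq)
    then have "\<iota> ` ?I \<subseteq> {x. (\<forall>k. 1 \<le> x k) \<and> (\<Sum>k\<in>UNIV. s k (x k)) \<le> L}"
      by (auto simp: cost opt_index_set_eq)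
    from K[OF L finite_imageI[OF fin] this]
    show "(\<Sum>x\<in>?I. exp (log_work \<gamma> \<delta> x)) \<le> K * exp (c * L) * (1 + L) ^ (card Z - 1)"
      using inj_on_subset[OF inj subset_UNIV] by (simp add: sum.reindex work)
  qed
qed

text \<open>Removing the finite set \<open>I\<close> from the telescoping series leaves the signed
  error as a limit of finite sums over \<open>X - I\<close>, so a uniform bound on finite sums of
  error contributions carries over.\<close>

lemma misc_error_le:
  fixes G :: "nat ^ 'D::finite \<Rightarrow> nat ^ 'N::finite \<Rightarrow> real"
  assumes G: "((\<lambda>(\<alpha>, \<beta>). mixed_diff G \<alpha> \<beta>) has_sum v) X"
    and I: "finite I" "I \<subseteq> X"
    and bound: "\<And>A. finite A \<Longrightarrow> A \<subseteq> X - I \<Longrightarrow> (\<Sum>(\<alpha>, \<beta>)\<in>A. error_contrib G \<alpha> \<beta>) \<le> E"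
  shows "misc_error v G I \<le> E"
proof -
  let ?d = "\<lambda>(\<alpha>, \<beta>). mixed_diff G \<alpha> \<beta>"
  have "(?d has_sum (v - sum ?d I)) (X - I)"
    using G I by (intro has_sum_Diff has_sum_finite)
  then have lim: "(sum ?d \<longlongrightarrow> v - sum ?d I) (finite_subsets_at_top (X - I))"
    by (simp add: has_sum_def)
  have "\<bar>v - sum ?d I\<bar> \<le> E"
  proof (rule tendsto_upperbound[OF tendsto_rabs[OF lim]])
    show "\<forall>\<^sub>F A in finite_subsets_at_top (X - I). \<bar>sum ?d A\<bar> \<le> E"
    proof (rule eventually_finite_subsets_at_top_weakI)
      fix A assume A: "finite A" "A \<subseteq> X - I"
      have "\<bar>sum ?d A\<bar> \<le> (\<Sum>x\<in>A. \<bar>?d x\<bar>)" by (rule sum_abs)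
      also have "\<dots> = (\<Sum>(\<alpha>, \<beta>)\<in>A. error_contrib G \<alpha> \<beta>)"
        by (simp add: error_contrib_def case_prod_beta)
      finally show "\<bar>sum ?d A\<bar> \<le> E" using bound[OF A] by linarith
    qed
  qed simp
  then show ?thesis by (simp add: misc_error_def misc_estimator_def)
qed

text \<open>Above the threshold \<open>C * exp c\<close> the argument of the inner logarithm is at least \<open>1\<close>, so the
  correction term only lowers the level.\<close>

lemma level_of_work:
  fixes c C W :: real
  assumes c: "0 < c" and C: "0 < C" and W: "C * exp c \<le> W"
  defines "\<Lambda> \<equiv> 1 / c * ln (W / C)"
  shows "1 \<le> \<Lambda>" "level_of_work c (Suc p) C W \<le> \<Lambda>"
    "exp (c * level_of_work c (Suc p) C W) = W / C / \<Lambda> ^ p"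
proof -
  have "exp c \<le> W / C" using C W by (simp add: field_simps)
  then have WC: "0 < W / C" "c \<le> ln (W / C)"
    by (smt (verit) exp_gt_zero, smt (verit) exp_gt_zero ln_ge_iff)
  show \<Lambda>: "1 \<le> \<Lambda>" using WC c by (simp add: \<Lambda>_def)
  have L: "level_of_work c (Suc p) C W = \<Lambda> - real p * ln \<Lambda> / c"
    by (simp add: level_of_work_def \<Lambda>_def diff_divide_distrib)
  have "0 \<le> real p * ln \<Lambda> / c" using \<Lambda> c by simp
  then show "level_of_work c (Suc p) C W \<le> \<Lambda>" by (simp add: L)
  have "c * level_of_work c (Suc p) C W = ln (W / C) - real p * ln \<Lambda>"
    using c by (simp add: L right_diff_distrib) (simp add: \<Lambda>_def)
  then show "exp (c * level_of_work c (Suc p) C W) = W / C / \<Lambda> ^ p"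
    using WC(1) \<Lambda> by (simp add: exp_diff exp_of_nat_mult)
qed

text \<open>With \<open>x = ln (W / C) / c\<close> the level is
  \<open>x - (z - 1) / c * ln x\<close>, and the linear term dominates. This makes the level
  eventually nonnegative, as the error estimate requires.\<close>

lemma level_of_work_at_top:
  assumes "0 < c" "0 < C"
  shows "filterlim (level_of_work c z C) at_top at_top"
proof -
  have 1: "filterlim (\<lambda>W. 1 / c * ln (W / C)) at_top at_top"
    using assms by real_asymp
  have 2: "filterlim (\<lambda>x::real. x - (real z - 1) / c * ln x) at_top at_top"
  proof (cases "real z - 1 = 0")
    case True
    then show ?thesis by (simp add: filterlim_ident)
  next
    case False
    then have "(real z - 1) / c \<noteq> 0" using assms by simp
    \<comment> \<open>The asymptotics are computed for a coefficient of known sign; the negative one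
      is the case \<open>z = 0\<close>.\<close>
    then consider "(real z - 1) / c > 0" | "(real z - 1) / c < 0" by linarith
    then show ?thesis by cases real_asymp+
  qed
  show ?thesis
    using filterlim_compose[OF 2 1] assms by (simp add: level_of_work_def [abs_def] algebra_simps diff_divide_distrib)
qed

theorem theorem1:
  fixes a b :: "real ^ 'x"
    and \<Gamma> :: "'N::finite \<Rightarrow> real set"
    and ev :: "'v::{real_inner,complete_space} \<Rightarrow> real ^ 'x \<Rightarrow> real"
    and Lop :: "(real ^ 'x \<Rightarrow> real) \<Rightarrow> real ^ 'x \<Rightarrow> real ^ 'N \<Rightarrow> real"
    and rhs :: "real ^ 'x \<Rightarrow> real"
    and u :: "real ^ 'N \<Rightarrow> 'v"
    and \<Theta> :: "'v \<Rightarrow> real"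
    and F :: "real ^ 'N \<Rightarrow> real"
    and h :: "'D::finite \<Rightarrow> nat \<Rightarrow> real"
    and solver :: "real ^ 'D \<Rightarrow> real ^ 'N \<Rightarrow> 'v"
    and udisc :: "nat ^ 'D \<Rightarrow> real ^ 'N \<Rightarrow> 'v"
    and Fdisc :: "nat ^ 'D \<Rightarrow> real ^ 'N \<Rightarrow> real"
    and m :: "nat \<Rightarrow> nat"
    and node :: "'N \<Rightarrow> nat \<Rightarrow> nat \<Rightarrow> real"
    and Fapp :: "nat ^ 'D \<Rightarrow> nat ^ 'N \<Rightarrow> real"
    and dW :: "nat ^ 'D \<Rightarrow> nat ^ 'N \<Rightarrow> real"
    and dWdet dEdet :: "nat ^ 'D \<Rightarrow> real"
    and dWstoc dEstoc :: "nat ^ 'N \<Rightarrow> real"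
    and h0 Cmlow Cmup Cwdet Cedet Cwstoc' Cwstoc Cestoc :: real
    and \<gamma>' r' :: "'D \<Rightarrow> real" and g' :: "'N \<Rightarrow> real"
    and \<gamma> r :: "'D \<Rightarrow> real" and g :: "'N \<Rightarrow> real" and \<delta> :: real
    and chi zeta :: real and z :: nat
  assumes dim: "CARD('x) \<in> {1, 2, 3}"
    and box: "\<And>i. a $ i < b $ i"
    and Gamma: "\<And>n. \<Gamma> n \<in> sets borel" "\<And>n. 0 < emeasure lborel (\<Gamma> n)"
      "\<And>n. emeasure lborel (\<Gamma> n) < \<infinity>"
    and ev_linear: "\<And>s v w x. ev (s *\<^sub>R v + w) x = s * ev v x + ev w x"
    and ev_inj: "\<And>v. (\<And>x. x \<in> box a b \<Longrightarrow> ev v x = 0) \<Longrightarrow> v = 0"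
    and u_solves: "AE y in param_law \<Gamma>. pde_solution (box a b) Lop rhs ev y (u y)"
    and well_posed: "AE y in param_law \<Gamma>. \<exists>!v. pde_solution (box a b) Lop rhs ev y v"
    and F: "F = (\<lambda>y. \<Theta> (u y))" "integrable (param_law \<Gamma>) F"
    and udisc: "udisc = (\<lambda>\<alpha>. solver (\<chi> i. h i (\<alpha> $ i)))"
    and udisc_conv: "AE y in param_law \<Gamma>.
      ((\<lambda>\<alpha>. udisc \<alpha> y) \<longlongrightarrow> u y) (filtercomap (\<lambda>\<alpha>. Min (range (\<lambda>i. \<alpha> $ i))) at_top)"
    and Fdisc: "Fdisc = (\<lambda>\<alpha> y. \<Theta> (udisc \<alpha> y))"
      "\<And>\<alpha>. \<alpha> \<in> pos_ind \<Longrightarrow> continuous_on (param_domain \<Gamma>) (Fdisc \<alpha>)"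
    and m: "strict_mono m" "m 0 = 0" "m 1 = 1"
    and node_mem: "\<And>n k l. 1 \<le> k \<Longrightarrow> l < m k \<Longrightarrow> node n (m k) l \<in> \<Gamma> n"
    and node_inj: "\<And>n k. 1 \<le> k \<Longrightarrow> inj_on (node n (m k)) {..<m k}"
    and Fapp: "Fapp = misc_approx \<Gamma> node m Fdisc"
    and dW_nonneg: "\<And>\<alpha> \<beta>. \<alpha> \<in> pos_ind \<Longrightarrow> \<beta> \<in> pos_ind \<Longrightarrow> 0 \<le> dW \<alpha> \<beta>"
    and telescoping:
      "((\<lambda>(\<alpha>, \<beta>). mixed_diff Fapp \<alpha> \<beta>) has_sum expect \<Gamma> F) (pos_ind \<times> pos_ind)"
    and A_pos: "0 < h0" "0 < Cmlow" "0 < Cmup"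
    and A_h: "\<And>i k. 1 \<le> k \<Longrightarrow> h i k = h0 * 2 powr (- real k)"
    and A_m: "\<And>k. 1 \<le> k \<Longrightarrow> Cmlow * 2 ^ k \<le> real (m k) \<and> real (m k) \<le> Cmup * 2 ^ k"
    and B_nonneg: "\<And>\<alpha>. \<alpha> \<in> pos_ind \<Longrightarrow> 0 \<le> dWdet \<alpha> \<and> 0 \<le> dEdet \<alpha>"
      "\<And>\<beta>. \<beta> \<in> pos_ind \<Longrightarrow> 0 \<le> dWstoc \<beta> \<and> 0 \<le> dEstoc \<beta>"
    and B_error: "\<And>\<alpha> \<beta>. \<alpha> \<in> pos_ind \<Longrightarrow> \<beta> \<in> pos_ind \<Longrightarrow>
      error_contrib Fapp \<alpha> \<beta> \<le> dEdet \<alpha> * dEstoc \<beta>"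
    and B_work: "\<And>\<alpha> \<beta>. \<alpha> \<in> pos_ind \<Longrightarrow> \<beta> \<in> pos_ind \<Longrightarrow> dW \<alpha> \<beta> \<le> dWdet \<alpha> * dWstoc \<beta>"
    and C_pos: "0 < Cwdet" "0 < Cedet" "0 < Cwstoc'" "0 < Cwstoc" "0 < Cestoc"
      "\<And>i. 0 < \<gamma>' i" "\<And>i. 0 < r' i" "\<And>n. 0 < g' n"
    and C_work_det: "\<And>\<alpha>. \<alpha> \<in> pos_ind \<Longrightarrow>
      dWdet \<alpha> \<le> Cwdet * (\<Prod>i\<in>UNIV. h i (\<alpha> $ i) powr (- \<gamma>' i))"
    and C_error_det: "\<And>\<alpha>. \<alpha> \<in> pos_ind \<Longrightarrow>
      dEdet \<alpha> \<le> Cedet * (\<Prod>i\<in>UNIV. h i (\<alpha> $ i) powr r' i)"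
    and C_work_stoc: "\<And>\<beta>. \<beta> \<in> pos_ind \<Longrightarrow>
      dWstoc \<beta> \<le> Cwstoc' * (\<Prod>n\<in>UNIV. real (m (\<beta> $ n))) \<and>
      Cwstoc' * (\<Prod>n\<in>UNIV. real (m (\<beta> $ n))) \<le> Cwstoc * (\<Prod>n\<in>UNIV. 2 ^ (\<beta> $ n))"
    and C_error_stoc: "\<And>\<beta>. \<beta> \<in> pos_ind \<Longrightarrow>
      dEstoc \<beta> \<le> Cestoc * exp (- (\<Sum>n\<in>UNIV. g' n * real (m (\<beta> $ n))))"
    and rates: "\<And>i. \<gamma> i = \<gamma>' i * ln 2" "\<And>i. r i = r' i * ln 2" "\<delta> = ln 2"
      "\<And>n. g n = g' n * Cmlow"
    and chi: "chi = Max (range (\<lambda>i. \<gamma> i / (\<gamma> i + r i)))"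
    and zeta: "zeta = Min (range (\<lambda>i. r i / \<gamma> i))"
    and z: "z = card {i. r i / \<gamma> i = zeta}"
  shows
    "(\<exists>Cwork>0. \<exists>Cerror>0. \<forall>\<alpha>\<in>pos_ind. \<forall>\<beta>\<in>pos_ind.
        dW \<alpha> \<beta> \<le> Cwork * exp (\<Sum>i\<in>UNIV. \<gamma> i * real (\<alpha> $ i)) * exp (\<delta> * real (vec_total \<beta>)) \<and>
        error_contrib Fapp \<alpha> \<beta> \<le>
          Cerror * exp (- (\<Sum>i\<in>UNIV. r i * real (\<alpha> $ i))) *
            exp (- (\<Sum>j\<in>UNIV. g j * exp (\<delta> * real (\<beta> $ j))))) \<and>
     (\<exists>CW>0.
        (\<forall>W. W \<ge> CW * exp chi \<longrightarrow>
           misc_work dW (opt_index_set r \<gamma> g \<delta> (level_of_work chi z CW W)) \<le> W) \<and>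
        (\<exists>CE::real.
           Limsup at_top (\<lambda>W. ereal
             (misc_error (expect \<Gamma> F) Fapp (opt_index_set r \<gamma> g \<delta> (level_of_work chi z CW W)) /
              (W powr (- zeta) * ln W powr ((zeta + 1) * (real z - 1))))) = ereal CE))"
proof -

  \<comment> \<open>Critical directions and the relation between \<open>chi\<close> and
    \<open>zeta\<close>\<close>
  define p where "p = z - 1"
  have pos: "0 < \<gamma> i" "0 < r i" "0 < g j" "0 < \<delta>" for i j
    using C_pos A_pos by (simp_all add: rates)
  \<comment> \<open>The work share is a decreasing function of \<open>r i / \<gamma> i\<close>, so
    its maximum \<open>chi\<close> sits where the minimum \<open>zeta\<close> is attained.\<close>
  have ratio: "\<gamma> i / (\<gamma> i + r i) = 1 / (1 + r i / \<gamma> i)" for i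
    using pos(1,2)[of i] by (simp add: field_simps)
  have zeta_le: "zeta \<le> r i / \<gamma> i" for i unfolding zeta by simp
  have "zeta \<in> range (\<lambda>i. r i / \<gamma> i)" unfolding zeta by (rule Min_in) auto
  then obtain i0 where i0: "zeta = r i0 / \<gamma> i0" by auto
  have zeta_pos: "0 < zeta" using pos(1,2)[of i0] by (simp add: i0)
  have chi_eq: "chi = 1 / (1 + zeta)"
    unfolding chi
  proof (rule Max_eqI)
    fix y assume "y \<in> range (\<lambda>i. \<gamma> i / (\<gamma> i + r i))"
    then show "y \<le> 1 / (1 + zeta)"
      using zeta_le zeta_pos by (auto simp: ratio intro!: divide_left_mono mult_pos_pos add_pos_pos divide_pos_pos pos)
  qed (auto simp: i0 ratio[symmetric])
  have chi: "0 < chi" "chi < 1" "1 - chi = chi * zeta" using zeta_pos by (simp_all add: chi_eq field_simps)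
  \<comment> \<open>Both claims follow from writing the gap as
    \<open>chi * \<gamma> i * (r i / \<gamma> i - zeta)\<close>, whose first two factors are
    positive.\<close>
  have le: "\<gamma> i \<le> chi * (r i + \<gamma> i)" and eq: "\<gamma> i = chi * (r i + \<gamma> i) \<longleftrightarrow> r i / \<gamma> i = zeta" for i
  proof -
    have "chi * (r i + \<gamma> i) - \<gamma> i = chi * \<gamma> i * (r i / \<gamma> i - zeta)"
    proof -
      have "chi * \<gamma> i * (r i / \<gamma> i - zeta) = chi * r i - (chi * zeta) * \<gamma> i"
        using pos(1)[of i] by (simp add: right_diff_distrib)
      then show ?thesis by (simp only: chi(3)[symmetric]) (simp add: algebra_simps)
    qed
    moreover have "0 < chi * \<gamma> i" using chi pos by simp
    ultimately show "\<gamma> i \<le> chi * (r i + \<gamma> i)" "\<gamma> i = chi * (r i + \<gamma> i) \<longleftrightarrow> r i / \<gamma> i = zeta"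
      using zeta_le[of i] mult_nonneg_nonneg[of "chi * \<gamma> i" "r i / \<gamma> i - zeta"]
      by (linarith, metis (no_types) diff_eq_diff_eq diff_self less_irrefl mult_eq_0_iff mult_zero_right)
  qed
  have z_set: "{i. r i / \<gamma> i = zeta} = {i. \<gamma> i = chi * (r i + \<gamma> i)}" by (simp add: eq)
  have nonempty: "{i. \<gamma> i = chi * (r i + \<gamma> i)} \<noteq> {}" using i0 eq by auto
  \<comment> \<open>Since the minimum is attained, \<open>z\<close> is positive and the natural
    subtraction in \<open>p\<close> does not truncate.\<close>
  then have z_p: "z = Suc p" unfolding p_def z z_set by (simp add: card_gt_0_iff)
  then have card_Z: "card {i. \<gamma> i = chi * (r i + \<gamma> i)} = Suc p" by (simp add: z z_set)

  \<comment> \<open>Exponential sums over the index set and over its complement\<close>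
  let ?X = "pos_ind \<times> pos_ind :: ((nat ^ 'D) \<times> (nat ^ 'N)) set"
  let ?S = "index_cost r \<gamma> g \<delta> :: _ \<times> (nat ^ 'N) \<Rightarrow> real" and ?T = "log_work \<gamma> \<delta> :: _ \<times> (nat ^ 'N) \<Rightarrow> real"
  have finite_I: "finite (opt_index_set r \<gamma> g \<delta> L)" for L
    using pos by (intro finite_opt_index_set) (auto intro: add_pos_pos less_imp_le)
  obtain K where K: "0 < K" and work_sum: "\<And>L. 0 \<le> L \<Longrightarrow>
      (\<Sum>x\<in>opt_index_set r \<gamma> g \<delta> L. exp (?T x)) \<le> K * exp (chi * L) * (1 + L) ^ p"
    by (rule work_sum_bound[where g = g, OF pos(2,1,3,4) chi(1) le refl nonempty]) (rule that; simp add: card_Z)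
  obtain K' where K': "0 < K'" and tail_sum: "\<And>L A. 0 \<le> L \<Longrightarrow> finite A \<Longrightarrow> A \<subseteq> {x \<in> ?X. L < ?S x} \<Longrightarrow>
      (\<Sum>x\<in>A. exp (?T x - ?S x)) \<le> K' * exp (- (1 - chi) * L) * (1 + L) ^ p"
  proof (rule tail_sum_bound[OF chi(1,2) K finite_I[unfolded opt_index_set_eq] work_sum[unfolded opt_index_set_eq]], goal_cases)
    case (2 K')
    show ?case by (rule that[OF 2(2,3)])
  qed

  \<comment> \<open>Exponential bounds on the single contributions\<close>
  define Cwork where "Cwork = Cwdet * (\<Prod>i\<in>UNIV. h0 powr (- \<gamma>' i)) * Cwstoc"
  define Cerror where "Cerror = Cedet * (\<Prod>i\<in>UNIV. h0 powr r' i) * Cestoc"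
  have Cwork: "0 < Cwork" and Cerror: "0 < Cerror"
    using C_pos A_pos by (simp_all add: Cwork_def Cerror_def prod_pos)
  \<comment> \<open>The powers of \<open>h0\<close> are independent of the level and move into the
    constants; only the powers of 2 become exponentials.\<close>
  have h_powr: "(\<Prod>i\<in>UNIV. h i (\<alpha> $ i) powr q i) = (\<Prod>i\<in>UNIV. h0 powr q i) * exp (- (\<Sum>i\<in>UNIV. q i * ln 2 * real (\<alpha> $ i)))"
    if "\<alpha> \<in> pos_ind" for \<alpha> and q :: "'D \<Rightarrow> real"
  proof -
    have "h i (\<alpha> $ i) powr q i = h0 powr q i * exp (- (q i * ln 2 * real (\<alpha> $ i)))" for i
      using that A_h[of "\<alpha> $ i" i] A_pos by (simp add: pos_ind_def powr_mult powr_powr) (simp add: powr_def mult_ac)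
    then show ?thesis by (simp add: prod.distrib exp_sum flip: sum_negf)
  qed
  have two_power: "exp (\<delta> * real n) = 2 ^ n" for n
    by (simp add: rates exp_of_nat2_mult)
  have work_bound: "dW \<alpha> \<beta> \<le> Cwork * exp (?T (\<alpha>, \<beta>))" if ab: "\<alpha> \<in> pos_ind" "\<beta> \<in> pos_ind" for \<alpha> \<beta>
  proof -
    have "dW \<alpha> \<beta> \<le> dWdet \<alpha> * dWstoc \<beta>" by (rule B_work[OF ab])
    also have "\<dots> \<le> (Cwdet * (\<Prod>i\<in>UNIV. h i (\<alpha> $ i) powr (- \<gamma>' i))) * (Cwstoc * (\<Prod>n\<in>UNIV. 2 ^ (\<beta> $ n)))"
      using B_nonneg ab C_work_det[OF ab(1)] C_work_stoc[OF ab(2)] C_pos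
      by (intro mult_mono) (auto intro: order_trans mult_nonneg_nonneg prod_nonneg less_imp_le)
    also have "(\<Prod>n\<in>UNIV. 2 ^ (\<beta> $ n)) = exp (\<delta> * real (vec_total \<beta>))"
      by (simp only: two_power vec_total_def power_sum)
    also have "(\<Prod>i\<in>UNIV. h i (\<alpha> $ i) powr (- \<gamma>' i)) = (\<Prod>i\<in>UNIV. h0 powr (- \<gamma>' i)) * exp (\<Sum>i\<in>UNIV. \<gamma> i * real (\<alpha> $ i))"
      by (subst h_powr[OF ab(1)]) (simp add: rates sum_negf)
    finally show ?thesis by (simp add: Cwork_def exp_log_work mult_ac)
  qed
  have error_bound: "error_contrib Fapp \<alpha> \<beta> \<le> Cerror * exp (?T (\<alpha>, \<beta>) - ?S (\<alpha>, \<beta>))"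
    if ab: "\<alpha> \<in> pos_ind" "\<beta> \<in> pos_ind" for \<alpha> \<beta>
  proof -
    \<comment> \<open>The lower bound on \<open>m\<close> in (A) turns decay in the number of points
      into decay in \<open>exp (\<delta> * \<beta>)\<close>; this is the source of
      \<open>Cmlow\<close> in \<open>g\<close>.\<close>
    have "g j * exp (\<delta> * real (\<beta> $ j)) \<le> g' j * real (m (\<beta> $ j))" for j
      using A_m[of "\<beta> $ j"] ab(2) C_pos(8)[of j] by (simp add: pos_ind_def rates(4) two_power mult.assoc)
    then have stoc: "exp (- (\<Sum>n\<in>UNIV. g' n * real (m (\<beta> $ n)))) \<le> exp (- (\<Sum>j\<in>UNIV. g j * exp (\<delta> * real (\<beta> $ j))))"
      by (simp add: sum_mono)
    have "error_contrib Fapp \<alpha> \<beta> \<le> dEdet \<alpha> * dEstoc \<beta>" by (rule B_error[OF ab])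
    also have "\<dots> \<le> (Cedet * (\<Prod>i\<in>UNIV. h i (\<alpha> $ i) powr r' i)) *
        (Cestoc * exp (- (\<Sum>j\<in>UNIV. g j * exp (\<delta> * real (\<beta> $ j)))))"
      using B_nonneg ab C_error_det[OF ab(1)] C_pos
        order_trans[OF C_error_stoc[OF ab(2)] mult_left_mono[OF stoc, of Cestoc]]
      by (intro mult_mono) (auto intro: order_trans)
    also have "\<dots> = Cerror * exp (?T (\<alpha>, \<beta>) - ?S (\<alpha>, \<beta>))"
      by (simp add: h_powr[OF ab(1)] exp_log_work_minus_cost Cerror_def rates(2) mult_ac)
    finally show ?thesis .
  qed

  \<comment> \<open>Total work and error at a given level\<close>
  have work_level: "misc_work dW (opt_index_set r \<gamma> g \<delta> L) \<le> Cwork * K * exp (chi * L) * (1 + L) ^ p" if "0 \<le> L" for L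
  proof -
    have "misc_work dW (opt_index_set r \<gamma> g \<delta> L) \<le> (\<Sum>x\<in>opt_index_set r \<gamma> g \<delta> L. Cwork * exp (?T x))"
      unfolding misc_work_def by (intro sum_mono) (auto simp: opt_index_set_eq work_bound)
    also have "\<dots> = Cwork * (\<Sum>x\<in>opt_index_set r \<gamma> g \<delta> L. exp (?T x))"
      by (simp add: sum_distrib_left)
    also have "\<dots> \<le> Cwork * (K * exp (chi * L) * (1 + L) ^ p)"
      using Cwork that by (intro mult_left_mono work_sum) auto
    finally show ?thesis by (simp add: mult_ac)
  qed
  have error_level: "misc_error (expect \<Gamma> F) Fapp (opt_index_set r \<gamma> g \<delta> L) \<le>
      Cerror * K' * exp (- (1 - chi) * L) * (1 + L) ^ p" if "0 \<le> L" for L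
  proof (rule misc_error_le[OF telescoping finite_I])
    show "opt_index_set r \<gamma> g \<delta> L \<subseteq> ?X" by (auto simp: opt_index_set_eq)
    fix A assume A: "finite A" "A \<subseteq> ?X - opt_index_set r \<gamma> g \<delta> L"
    have "(\<Sum>(\<alpha>, \<beta>)\<in>A. error_contrib Fapp \<alpha> \<beta>) \<le> (\<Sum>x\<in>A. Cerror * exp (?T x - ?S x))"
      using A by (intro sum_mono) (auto intro!: error_bound)
    also have "\<dots> = Cerror * (\<Sum>x\<in>A. exp (?T x - ?S x))"
      by (simp add: sum_distrib_left)
    also have "\<dots> \<le> Cerror * (K' * exp (- (1 - chi) * L) * (1 + L) ^ p)"
      using Cerror that A by (intro mult_left_mono tail_sum) (auto simp: opt_index_set_eq not_le)
    finally show "(\<Sum>(\<alpha>, \<beta>)\<in>A. error_contrib Fapp \<alpha> \<beta>) \<le> Cerror * K' * exp (- (1 - chi) * L) * (1 + L) ^ p"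
      by (simp add: mult_ac)
  qed
  \<comment> \<open>The logarithmic correction can make the level negative at an admissible
    \<open>W\<close>; the estimates for \<open>0 \<le> L\<close> then do not apply, but the index
    set is empty.\<close>
  have empty_I: "opt_index_set r \<gamma> g \<delta> L = {}" if "L < 0" for L
  proof -
    have "0 \<le> ?S x" for x
      unfolding index_cost_def using pos
      by (intro add_nonneg_nonneg sum_nonneg mult_nonneg_nonneg) (auto intro: less_imp_le)
    then show ?thesis using that by (auto simp: opt_index_set_eq not_le intro: less_le_trans)
  qed

  \<comment> \<open>The work budget\<close>
  \<comment> \<open>The factor \<open>2 ^ p\<close> pays for
    \<open>1 + level W \<le> 2 * \<Lambda> W\<close>. The power of \<open>\<Lambda> W\<close> then
    cancels against the one in \<open>exp (chi * level W)\<close>, and the bound is exactly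
    \<open>W\<close>.\<close>
  define CW where "CW = Cwork * K * 2 ^ p"
  have CW: "0 < CW" using Cwork K by (simp add: CW_def)
  define level where "level W = level_of_work chi z CW W" for W
  define \<Lambda> where "\<Lambda> W = 1 / chi * ln (W / CW)" for W
  have level: "1 \<le> \<Lambda> W" "level W \<le> \<Lambda> W" "exp (chi * level W) = W / CW / \<Lambda> W ^ p" "0 < W"
    if "CW * exp chi \<le> W" for W
    using level_of_work(1)[OF chi(1) CW that] level_of_work(2,3)[OF chi(1) CW that, of p] that CW
    by (auto simp: level_def \<Lambda>_def z_p intro: less_le_trans[OF mult_pos_pos[OF CW exp_gt_zero]])
  have work: "misc_work dW (opt_index_set r \<gamma> g \<delta> (level W)) \<le> W" if W: "CW * exp chi \<le> W" for W
  proof (cases "level W < 0")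
    case True
    then show ?thesis using level(4)[OF W] by (simp add: empty_I misc_work_def)
  next
    case False
    have "misc_work dW (opt_index_set r \<gamma> g \<delta> (level W)) \<le> Cwork * K * exp (chi * level W) * (1 + level W) ^ p"
      using False by (intro work_level) simp
    also have "\<dots> \<le> Cwork * K * exp (chi * level W) * (2 * \<Lambda> W) ^ p"
      using Cwork K False level(1,2)[OF W] by (intro mult_left_mono power_mono) auto
    also have "\<dots> = W"
      using level(1)[OF W] CW Cwork K by (simp add: level(3)[OF W] power_mult_distrib) (simp add: CW_def)
    finally show ?thesis .
  qed

  \<comment> \<open>The error rate in terms of the work\<close>
  let ?err = "\<lambda>W. misc_error (expect \<Gamma> F) Fapp (opt_index_set r \<gamma> g \<delta> (level W))"
  let ?rate = "\<lambda>W. W powr (- zeta) * ln W powr ((zeta + 1) * (real z - 1))"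
  define C where "C = Cerror * K' * 2 ^ p * CW powr zeta * (2 / chi) powr ((zeta + 1) * real p)"
  have ev_log: "\<forall>\<^sub>F W in at_top. \<Lambda> W \<le> 2 / chi * ln W"
  proof -
    \<comment> \<open>The factor 2 leaves room for \<open>- ln CW\<close>, which is positive when
      \<open>CW < 1\<close>.\<close>
    have "\<forall>\<^sub>F W in at_top. ln (W / CW) \<le> 2 * ln W" using CW by real_asymp
    then show ?thesis
    proof eventually_elim
      case (elim W)
      then show ?case using chi(1) by (simp add: \<Lambda>_def divide_right_mono)
    qed
  qed
  have ev_level: "\<forall>\<^sub>F W in at_top. 0 \<le> level W"
    using level_of_work_at_top[OF chi(1) CW, of z] by (simp add: level_def filterlim_at_top)
  have upper: "\<forall>\<^sub>F W in at_top. ?err W / ?rate W \<le> C"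
    using ev_log ev_level eventually_ge_at_top[of "CW * exp chi"] eventually_gt_at_top[of 1]
  proof eventually_elim
    case (elim W)
    note lv = level[OF elim(3)]
    have WC: "0 < W / CW" using lv CW by simp
    \<comment> \<open>As \<open>1 - chi = chi * zeta\<close>, the decay is the power
      \<open>- zeta\<close> of \<open>exp (chi * level W)\<close>. Its divisor
      \<open>\<Lambda> W ^ p\<close> reappears as \<open>\<Lambda> W\<close> to the power
      \<open>zeta * p\<close>; joined with the \<open>p\<close> from the polynomial factor this
      gives \<open>(zeta + 1) * p\<close>.\<close>
    have "exp (- (1 - chi) * level W) = exp (chi * level W) powr (- zeta)"
      by (simp add: chi(3) powr_def mult_ac)
    also have "\<dots> = (W / CW) powr (- zeta) * \<Lambda> W powr (zeta * real p)"
      using WC CW lv by (simp add: lv(3) powr_mult powr_divide powr_powr powr_minus powr_realpow[symmetric] field_simps)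
    finally have decay: "exp (- (1 - chi) * level W) = (W / CW) powr (- zeta) * \<Lambda> W powr (zeta * real p)" .
    have "?err W \<le> Cerror * K' * exp (- (1 - chi) * level W) * (1 + level W) ^ p"
      using elim by (intro error_level)
    also have "\<dots> \<le> Cerror * K' * exp (- (1 - chi) * level W) * (2 * \<Lambda> W) ^ p"
      using Cerror K' elim lv(1,2) by (intro mult_left_mono power_mono) auto
    also have "\<dots> = Cerror * K' * 2 ^ p * (W / CW) powr (- zeta) * (\<Lambda> W powr (zeta * real p) * \<Lambda> W powr real p)"
      using lv by (simp only: decay power_mult_distrib) (simp add: powr_realpow)
    also have "\<dots> = Cerror * K' * 2 ^ p * (W / CW) powr (- zeta) * \<Lambda> W powr ((zeta + 1) * real p)"
      by (simp add: powr_add[symmetric] algebra_simps)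
    also have "\<dots> \<le> Cerror * K' * 2 ^ p * (W / CW) powr (- zeta) * (2 / chi * ln W) powr ((zeta + 1) * real p)"
      using Cerror K' elim lv(1) zeta_pos by (intro mult_left_mono powr_mono2) auto
    also have "\<dots> = C * ?rate W"
    proof -
      have "(W / CW) powr (- zeta) = CW powr zeta * W powr (- zeta)"
        using lv CW by (simp add: powr_divide powr_minus field_simps)
      moreover have "(2 / chi * ln W) powr ((zeta + 1) * real p) = (2 / chi) powr ((zeta + 1) * real p) * ln W powr ((zeta + 1) * real p)"
        by (rule powr_mult)
      moreover have "real z - 1 = real p" by (simp add: z_p)
      ultimately show ?thesis by (simp only: C_def mult_ac)
    qed
    finally have "?err W \<le> C * ?rate W" .
    moreover have "0 < ?rate W" using lv elim by simp
    ultimately show ?case by (simp only: pos_divide_le_eq)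
  qed
  have "Limsup at_top (\<lambda>W. ereal (?err W / ?rate W)) \<le> ereal C"
    using upper by (intro Limsup_bounded) simp
  \<comment> \<open>The lower bound excludes minus infinity, so the limit superior is a real
    number.\<close>
  moreover have "0 \<le> Limsup at_top (\<lambda>W. ereal (?err W / ?rate W))"
  proof (rule order_trans[OF _ Liminf_le_Limsup])
    show "0 \<le> Liminf at_top (\<lambda>W. ereal (?err W / ?rate W))"
      by (intro Liminf_bounded always_eventually) (simp add: misc_error_def)
  qed simp
  ultimately have limsup: "\<exists>CE. Limsup at_top (\<lambda>W. ereal (?err W / ?rate W)) = ereal CE"
    by (cases "Limsup at_top (\<lambda>W. ereal (?err W / ?rate W))") auto

  have "\<exists>Cwork>0. \<exists>Cerror>0. \<forall>\<alpha>\<in>pos_ind. \<forall>\<beta>\<in>pos_ind.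
      dW \<alpha> \<beta> \<le> Cwork * exp (\<Sum>i\<in>UNIV. \<gamma> i * real (\<alpha> $ i)) * exp (\<delta> * real (vec_total \<beta>)) \<and>
      error_contrib Fapp \<alpha> \<beta> \<le>
        Cerror * exp (- (\<Sum>i\<in>UNIV. r i * real (\<alpha> $ i))) * exp (- (\<Sum>j\<in>UNIV. g j * exp (\<delta> * real (\<beta> $ j))))"
    using work_bound error_bound Cwork Cerror
    by (intro exI[of _ Cwork] conjI exI[of _ Cerror]) (simp_all add: exp_log_work exp_log_work_minus_cost mult.assoc)
  then show ?thesis
    using work limsup CW unfolding level_def by blast
qed

end
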